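(* Suppose $N,m,i,j\in\mathbb{Z}$ with $N\ge 3$, $1\le i,j\le N$ and $i\ne j$. There exists a word $w_m$ in the letters $\{e_{pq}^{\pm1}\mid 1\le p,q\le N,\ p\ne q\}$ such that $w_m=e_{ij}^{\,m}$ in $\mathrm{SL}_N(\mathbb{Z})$ and the length $\ell(w_m)$ of $w_m$ satisfies $$\ell(w_m)\ \le\ 4+6\log_{\tau}(1+|m|\sqrt5).$$
   Context: For $p\neq q$, $e_{pq}$ denotes the $N\times N$ elementary matrix with $1$'s along the diagonal, $pq$-entry equal to $1$, and all other entries $0$. $\tau:=(1+\sqrt5)/2$. The length of a word is its number of letters. *)

theory Defs
  imports Complex_Main "HOL-Algebra.Group" "Jordan_Normal_Form.Determinant"
begin

definition SL_Z :: "nat \<Rightarrow> int mat monoid" where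
  "SL_Z N = \<lparr>carrier = {A \<in> carrier_mat N N. det A = 1}, mult = (*), one = 1\<^sub>m N\<rparr>"

lemma group_SL_Z: "group (SL_Z N)"
proof (rule groupI)
  fix A assume "A \<in> carrier (SL_Z N)"
  then have A: "A \<in> carrier_mat N N" "det A = 1"
    by (auto simp: SL_Z_def)
  have inv: "adj_mat A * A = 1\<^sub>m N"
    using adj_mat(3)[OF A(1)] A(2) by auto
  then have "det (adj_mat A) * det A = 1"
    using det_mult[OF adj_mat(1)[OF A(1)] A(1)] by simp
  then have "det (adj_mat A) = 1"
    using A(2) by simp
  then show "\<exists>B\<in>carrier (SL_Z N). B \<otimes>\<^bsub>SL_Z N\<^esub> A = \<one>\<^bsub>SL_Z N\<^esub>"
    using inv adj_mat(1)[OF A(1)] by (auto simp: SL_Z_def)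
qed (auto simp: SL_Z_def det_mult assoc_mult_mat[of _ N N _ N _ N])

text \<open>As everywhere in the matrix library, rows and columns are numbered from \<open>0\<close>
  to \<open>N - 1\<close>. The library's \<open>addrow_mat N 1 p q\<close> is the identity matrix with \<open>1\<close> added to
  the \<open>(p, q)\<close> entry.\<close>

definition elem_mat :: "nat \<Rightarrow> nat \<Rightarrow> nat \<Rightarrow> int mat" where
  "elem_mat N p q = addrow_mat N 1 p q"

lemma elem_mat_SL_Z: "p \<noteq> q \<Longrightarrow> elem_mat N p q \<in> carrier (SL_Z N)"
  by (simp add: SL_Z_def elem_mat_def det_addrow_mat)

definition letters :: "nat \<Rightarrow> int mat set" where
  "letters N =
     {elem_mat N p q | p q. p < N \<and> q < N \<and> p \<noteq> q} \<union>
     {inv\<^bsub>SL_Z N\<^esub> (elem_mat N p q) | p q. p < N \<and> q < N \<and> p \<noteq> q}"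

definition eval_word :: "nat \<Rightarrow> int mat list \<Rightarrow> int mat" where
  "eval_word N w = foldr (\<lambda>x y. x \<otimes>\<^bsub>SL_Z N\<^esub> y) w \<one>\<^bsub>SL_Z N\<^esub>"

definition tau :: real where
  "tau = (1 + sqrt 5) / 2"

end

theory Submission
  imports Defs "HOL-Number_Theory.Fib"
begin

text \<open>Fix a third index \<open>k\<close>. Conjugation by \<open>e\<^sub>i\<^sub>k\<^sup>\<plusminus>\<^sup>1\<close> and \<open>e\<^sub>k\<^sub>i\<^sup>\<plusminus>\<^sup>1\<close> acts on the abelian group
  generated by \<open>e\<^sub>i\<^sub>j\<close> and \<open>e\<^sub>k\<^sub>j\<close> by elementary row operations on the exponents. Alternating the two,
  and inserting a letter \<open>e\<^sub>i\<^sub>j\<close> or \<open>e\<^sub>k\<^sub>j\<close> at some of the steps, is Horner's scheme for Fibonacci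
  expansions: \<open>n\<close> steps cost at most \<open>3n\<close> letters and reach every exponent \<open>p < fib (n + 2)\<close> on
  \<open>e\<^sub>i\<^sub>j\<close>, together with some uncontrolled exponent \<open>q\<close> on \<open>e\<^sub>k\<^sub>j\<close>. The mirror image of the word
  yields the exponents \<open>p\<close> and \<open>- q\<close>, so the product of both is \<open>e\<^sub>i\<^sub>j\<^sup>2\<^sup>p\<close>, and one more letter settles
  odd exponents.\<close>

section \<open>Products of elementary matrices and their integer powers\<close>

lemma addrow_mat_zero: "k \<noteq> l \<Longrightarrow> addrow_mat n 0 k l = (1\<^sub>m n :: 'a :: semiring_1 mat)"
  by (rule eq_matI) auto

lemma addrow_mat_add:
  fixes x y :: "'a :: comm_ring_1"
  assumes "k \<noteq> l" "l < n"
  shows "addrow_mat n x k l * addrow_mat n y k l = addrow_mat n (x + y) k l"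
  \<comment> \<open>Left multiplication becomes the row operation \<open>addrow\<close>, so entries
    can be compared without expanding matrix products.\<close>
  unfolding addrow_mat[OF addrow_mat_carrier assms(2), symmetric]
  using assms by (intro eq_matI) (auto simp: algebra_simps)

lemma addrow_mat_commute:
  fixes x y :: "'a :: comm_ring_1"
  assumes "i \<noteq> j" "k \<noteq> j" "j < n"
  shows "addrow_mat n x i j * addrow_mat n y k j = addrow_mat n y k j * addrow_mat n x i j"
  unfolding addrow_mat[OF addrow_mat_carrier assms(3), symmetric]
  using assms by (intro eq_matI) (auto simp: algebra_simps)

text \<open>The commutator relation for the index pairs \<open>(i, k)\<close> and
  \<open>(k, j)\<close>. The factors come out in swapped order, which lets the roles of
  \<open>i\<close> and \<open>k\<close> alternate in the later induction.\<close>

lemma addrow_mat_conjugate: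
  fixes x y c :: "'a :: comm_ring_1"
  assumes "i \<noteq> j" "k \<noteq> j" "i \<noteq> k" "j < n" "k < n"
  shows "addrow_mat n c i k * (addrow_mat n x k j * addrow_mat n y i j) * addrow_mat n (- c) i k
    = addrow_mat n (y + c * x) i j * addrow_mat n x k j"
proof -
  \<comment> \<open>Without the inverse and associated to the right, both sides are iterated row
    operations on one matrix.\<close>
  have "addrow_mat n c i k * (addrow_mat n x k j * addrow_mat n y i j)
      = addrow_mat n (y + c * x) i j * addrow_mat n x k j * addrow_mat n c i k"
    using assms
    by (simp only: assoc_mult_mat[of _ n n _ n _ n] addrow_mat_carrier mult_carrier_mat[of _ n n _ n])
       (simp add: addrow_mat[of _ n n, symmetric], intro eq_matI, auto simp: algebra_simps)
  then have "addrow_mat n c i k * (addrow_mat n x k j * addrow_mat n y i j) * addrow_mat n (- c) i k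
      = addrow_mat n (y + c * x) i j * addrow_mat n x k j *
        (addrow_mat n c i k * addrow_mat n (- c) i k)"
    by (simp only: assoc_mult_mat[of _ n n _ n _ n] addrow_mat_carrier mult_carrier_mat[of _ n n _ n])
  also have "addrow_mat n c i k * addrow_mat n (- c) i k = 1\<^sub>m n"
    using assms by (simp add: addrow_mat_add addrow_mat_zero)
  finally show ?thesis
    by (simp add: right_mult_one_mat[of _ n n] mult_carrier_mat[of _ n n _ n])
qed

lemma inv_elem_mat:
  assumes "p \<noteq> q" "q < N"
  shows "inv\<^bsub>SL_Z N\<^esub> (elem_mat N p q) = addrow_mat N (-1) p q"
proof (rule group.inv_equality[OF group_SL_Z])
  show "addrow_mat N (-1) p q \<otimes>\<^bsub>SL_Z N\<^esub> elem_mat N p q = \<one>\<^bsub>SL_Z N\<^esub>"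
    using assms by (simp add: SL_Z_def elem_mat_def addrow_mat_add addrow_mat_zero)
qed (use assms in \<open>auto simp: elem_mat_def SL_Z_def det_addrow_mat\<close>)

lemma elem_mat_int_pow:
  assumes "p \<noteq> q" "q < N"
  shows "elem_mat N p q [^]\<^bsub>SL_Z N\<^esub> (m :: int) = addrow_mat N m p q"
proof -
  interpret group "SL_Z N" by (rule group_SL_Z)
  have nat: "elem_mat N p q [^]\<^bsub>SL_Z N\<^esub> (n :: nat) = addrow_mat N (int n) p q" for n
  proof (induction n)
    case 0
    then show ?case using assms by (simp add: SL_Z_def addrow_mat_zero)
  next
    case (Suc n)
    then show ?case
      using assms by (simp add: SL_Z_def elem_mat_def addrow_mat_add add.commute)
  qed
  show ?thesis
  proof (cases m rule: int_cases2)
    case (nonneg n)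
    then show ?thesis by (simp add: int_pow_int nat)
  next
    case (nonpos n)
    have "inv\<^bsub>SL_Z N\<^esub> (addrow_mat N (int n) p q) = addrow_mat N (- int n) p q"
    proof (rule inv_equality)
      show "addrow_mat N (- int n) p q \<otimes>\<^bsub>SL_Z N\<^esub> addrow_mat N (int n) p q = \<one>\<^bsub>SL_Z N\<^esub>"
        using assms by (simp add: SL_Z_def addrow_mat_add addrow_mat_zero)
    qed (use assms in \<open>auto simp: SL_Z_def det_addrow_mat\<close>)
    then show ?thesis
      using assms nonpos by (simp add: int_pow_neg_int elem_mat_SL_Z nat)
  qed
qed

section \<open>Words of bounded length\<close>

definition spelled_within :: "nat \<Rightarrow> nat \<Rightarrow> int mat \<Rightarrow> bool" where
  "spelled_within N l A \<longleftrightarrow> (\<exists>w \<in> lists (letters N). eval_word N w = A \<and> length w \<le> l)"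

lemma eval_word_simps [simp]:
  "eval_word N [] = 1\<^sub>m N"
  "eval_word N (x # w) = x * eval_word N w"
  by (simp_all add: eval_word_def SL_Z_def)

lemma letters_carrier_mat: "letters N \<subseteq> carrier_mat N N"
  by (auto simp: letters_def inv_elem_mat) (auto simp: elem_mat_def)

lemma eval_word_carrier_mat:
  "w \<in> lists (letters N) \<Longrightarrow> eval_word N w \<in> carrier_mat N N"
  using letters_carrier_mat by (induction w) (auto intro!: mult_carrier_mat)

lemma eval_word_append:
  assumes "u \<in> lists (letters N)" "v \<in> lists (letters N)"
  shows "eval_word N (u @ v) = eval_word N u * eval_word N v"
  using assms(1)
proof (induction u)
  case Nil
  then show ?case using eval_word_carrier_mat[OF assms(2)] by simp
next
  case (Cons x u)
  then have "x \<in> carrier_mat N N" "eval_word N u \<in> carrier_mat N N"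
    using letters_carrier_mat eval_word_carrier_mat by auto
  then show ?case
    using Cons eval_word_carrier_mat[OF assms(2)]
    by (simp add: assoc_mult_mat[of _ N N _ N _ N])
qed

lemma spelled_within_mult:
  assumes "spelled_within N a A" "spelled_within N b B"
  shows "spelled_within N (a + b) (A * B)"
proof -
  obtain u v where "u \<in> lists (letters N)" "eval_word N u = A" "length u \<le> a"
    and "v \<in> lists (letters N)" "eval_word N v = B" "length v \<le> b"
    using assms unfolding spelled_within_def by auto
  then show ?thesis
    unfolding spelled_within_def by (intro bexI[of _ "u @ v"]) (auto simp: eval_word_append)
qed

lemma spelled_within_one: "spelled_within N l (1\<^sub>m N)"
  unfolding spelled_within_def by (intro bexI[of _ "[]"]) auto

text \<open>Admitting exponent \<open>0\<close> lets optional letters be charged uniformly, with no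
  case distinction on the digits.\<close>

lemma spelled_within_addrow_mat:
  assumes "p < N" "q < N" "p \<noteq> q" "c \<in> {-1, 0, 1}"
  shows "spelled_within N 1 (addrow_mat N c p q)"
proof (cases "c = 0")
  case True
  then show ?thesis using assms spelled_within_one by (simp add: addrow_mat_zero)
next
  case False
  then have c: "c = 1 \<or> c = -1" using assms by auto
  have "elem_mat N p q \<in> letters N" "inv\<^bsub>SL_Z N\<^esub> (elem_mat N p q) \<in> letters N"
    unfolding letters_def using assms by blast+
  then have "addrow_mat N c p q \<in> letters N"
    using c assms by (auto simp: elem_mat_def[symmetric] inv_elem_mat)
  then show ?thesis
    unfolding spelled_within_def by (intro bexI[of _ "[addrow_mat N c p q]"]) auto
qed

section \<open>Fibonacci expansions and the words that realise them\<close>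

lemma spelled_within_fib_expansion:
  fixes d :: "nat \<Rightarrow> int"
  assumes "i < N" "k < N" "j < N" "i \<noteq> j" "k \<noteq> j" "i \<noteq> k"
    and "\<And>r. d r \<in> {0, 1}" "s \<in> {-1, 1}" "t \<in> {-1, 1}"
  shows "spelled_within N (3 * n)
    (addrow_mat N (s * (\<Sum>r<n. d r * int (fib (Suc r)))) i j *
     addrow_mat N (t * (\<Sum>r<n. d r * int (fib r))) k j)"
  using assms
\<comment> \<open>Each step swaps \<open>i\<close> with \<open>k\<close> and \<open>s\<close> with
  \<open>t\<close> and shifts the digits, so all of these are generalised.\<close>
proof (induction n arbitrary: i k d s t)
  case 0
  then show ?case using spelled_within_one by (simp add: addrow_mat_zero)
next
  case (Suc n)
  define x where "x = (\<Sum>r<n. d (Suc r) * int (fib (Suc r)))"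
  define y where "y = (\<Sum>r<n. d (Suc r) * int (fib r))"
  \<comment> \<open>The Fibonacci recurrence splits the shifted sum into \<open>x + y\<close>; since
    \<open>fib 0 = 0\<close> and \<open>fib 1 = 1\<close>, the digit \<open>d 0\<close> enters only
    the first exponent.\<close>
  have first: "(\<Sum>r<Suc n. d r * int (fib (Suc r))) = d 0 + (x + y)"
    by (subst sum.lessThan_Suc_shift) (simp add: x_def y_def sum.distrib algebra_simps)
  have second: "(\<Sum>r<Suc n. d r * int (fib r)) = x"
    by (subst sum.lessThan_Suc_shift) (simp add: x_def)
  \<comment> \<open>As \<open>t * t = 1\<close>, conjugating with sign \<open>s * t\<close> adds a
    term of sign \<open>s\<close>.\<close>
  have tt: "s * t * (t * x) = s * x" using Suc.prems by auto
  have "spelled_within N (3 * n) (addrow_mat N (t * x) k j * addrow_mat N (s * y) i j)"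
    unfolding x_def y_def using Suc.prems by (intro Suc.IH) auto
  \<comment> \<open>Two letters pay for the conjugation and one for the digit
    \<open>d 0\<close>.\<close>
  then have "spelled_within N (1 + (1 + 3 * n + 1))
      (addrow_mat N (s * d 0) i j *
        (addrow_mat N (s * t) i k * (addrow_mat N (t * x) k j * addrow_mat N (s * y) i j) *
         addrow_mat N (- (s * t)) i k))"
    using Suc.prems(1-6,8,9) Suc.prems(7)[of 0]
    by (intro spelled_within_mult spelled_within_addrow_mat) auto
  also have "addrow_mat N (s * t) i k * (addrow_mat N (t * x) k j * addrow_mat N (s * y) i j) *
      addrow_mat N (- (s * t)) i k = addrow_mat N (s * y + s * x) i j * addrow_mat N (t * x) k j"
    using Suc.prems by (subst addrow_mat_conjugate) (auto simp: tt)
  also have "addrow_mat N (s * d 0) i j * \<dots>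
      = addrow_mat N (s * (d 0 + (x + y))) i j * addrow_mat N (t * x) k j"
    using Suc.prems
    by (simp add: assoc_mult_mat[of _ N N _ N _ N, symmetric] addrow_mat_add algebra_simps)
  also have "1 + (1 + 3 * n + 1) = 3 * Suc n" by simp
  finally show ?case
    unfolding first second .
qed

text \<open>Greedy choice of digits: if \<open>fib (n + 1)\<close> fits into
  \<open>a < fib (n + 3)\<close>, subtracting it leaves less than \<open>fib (n + 2)\<close>;
  otherwise \<open>a\<close> is already below that bound.\<close>

lemma fib_expansion:
  "a < fib (n + 2) \<Longrightarrow>
    \<exists>d :: nat \<Rightarrow> int. (\<forall>r. d r \<in> {0, 1}) \<and> int a = (\<Sum>r<n. d r * int (fib (Suc r)))"
proof (induction n arbitrary: a)
  case 0
  then show ?case by (auto simp: numeral_2_eq_2 intro: exI[of _ "\<lambda>_. 0"])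
next
  case (Suc n)
  define c where "c = (if fib (Suc n) \<le> a then 1 else 0 :: nat)"
  have "a - c * fib (Suc n) < fib (n + 2)" and le: "c * fib (Suc n) \<le> a"
    using Suc.prems by (auto simp: c_def)
  then obtain d :: "nat \<Rightarrow> int" where d: "\<forall>r. d r \<in> {0, 1}"
    "int (a - c * fib (Suc n)) = (\<Sum>r<n. d r * int (fib (Suc r)))"
    using Suc.IH by blast
  have "int a = (\<Sum>r<Suc n. (d(n := int c)) r * int (fib (Suc r)))"
    using d(2) le by (simp add: of_nat_diff)
  moreover have "\<forall>r. (d(n := int c)) r \<in> {0, 1}"
    using d(1) by (simp add: c_def)
  ultimately show ?case by blast
qed

section \<open>Growth of the Fibonacci numbers\<close>

lemma tau_gt_1: "tau > 1" and tau_le_2: "tau \<le> 2" and tau_square: "tau\<^sup>2 = tau + 1"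
proof -
  have "sqrt 5 > 1" "sqrt 5 \<le> 3" by (simp_all add: real_le_lsqrt)
  then show "tau > 1" "tau \<le> 2" by (simp_all add: tau_def)
  show "tau\<^sup>2 = tau + 1" by (simp add: tau_def power2_eq_square field_simps)
qed

text \<open>Both sides satisfy the same recurrence, because \<open>tau\<^sup>2 = tau + 1\<close>;
  the shift by \<open>2\<close> makes the initial values \<open>1 \<le> 1\<close> and
  \<open>tau \<le> 2\<close>.\<close>

lemma tau_power_le_fib: "tau ^ n \<le> real (fib (n + 2))"
proof (induction n rule: fib.induct)
  case 1
  then show ?case by (simp add: numeral_2_eq_2)
next
  case 2
  then show ?case using tau_le_2 by (simp add: numeral_2_eq_2)
next
  case (3 n)
  have "tau ^ Suc (Suc n) = tau\<^sup>2 * tau ^ n" by (simp add: power2_eq_square)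
  also have "\<dots> = tau ^ Suc n + tau ^ n" by (simp add: tau_square algebra_simps)
  finally have "tau ^ Suc (Suc n) = tau ^ Suc n + tau ^ n" .
  then show ?case using 3 by simp
qed

section \<open>Assembling the word and bounding its length\<close>

theorem proposition2p1:
  fixes N i j :: nat and m :: int
  assumes "N \<ge> 3" and "i < N" and "j < N" and "i \<noteq> j"
  shows "\<exists>w. w \<in> lists (letters N) \<and>
    eval_word N w = elem_mat N i j [^]\<^bsub>SL_Z N\<^esub> m \<and>
    real (length w) \<le> 4 + 6 * log tau (1 + real_of_int \<bar>m\<bar> * sqrt 5)"
proof -
  have "card {i, j} < card {..<N}" using assms by simp
  then have "\<not> {..<N} \<subseteq> {i, j}" using card_mono[of "{i, j}" "{..<N}"] by auto
  then obtain k where k: "k < N" "k \<noteq> i" "k \<noteq> j" by auto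
  define s where "s = (if m < 0 then -1 else 1 :: int)"
  define a where "a = nat \<bar>m\<bar> div 2"
  define b where "b = \<bar>m\<bar> mod 2"
  have s: "s \<in> {-1, 1}" and b: "b \<in> {0, 1}"
    by (auto simp: s_def b_def)
  have "2 * int a + b = \<bar>m\<bar>" by (simp add: a_def b_def zdiv_int)
  then have m: "m = s * (2 * int a + b)" by (simp add: s_def)
  have "real a \<le> tau ^ a + 0 \<Longrightarrow> True" by simp
  have ex: "\<exists>n. a < fib (n + 2)"
  proof -
    obtain n where "real a < tau ^ n" using real_arch_pow[OF tau_gt_1] by blast
    then have "a < fib (n + 2)" using tau_power_le_fib[of n] by linarith
    then show ?thesis ..
  qed
  \<comment> \<open>Membership in the set gives an expansion of \<open>a\<close> with
    \<open>n\<close> digits; minimality will bound \<open>n\<close> logarithmically.\<close>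
  define n where "n = (LEAST n. a < fib (n + 2))"
  have n: "a < fib (n + 2)" unfolding n_def using ex by (rule LeastI_ex)
  obtain d :: "nat \<Rightarrow> int" where d: "\<And>r. d r \<in> {0, 1}"
    and a: "int a = (\<Sum>r<n. d r * int (fib (Suc r)))"
    using fib_expansion[OF n] by blast
  define q where "q = (\<Sum>r<n. d r * int (fib r))"
  have half: "spelled_within N (3 * n) (addrow_mat N (s * int a) i j * addrow_mat N (t * q) k j)"
    if "t \<in> {-1, 1}" for t
    unfolding a q_def using assms k d s that by (intro spelled_within_fib_expansion) auto
  have "spelled_within N (3 * n + 3 * n + 1)
      (addrow_mat N (s * int a) i j * addrow_mat N (1 * q) k j *
       (addrow_mat N (s * int a) i j * addrow_mat N (-1 * q) k j) * addrow_mat N (s * b) i j)"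
    using assms s b by (intro spelled_within_mult half spelled_within_addrow_mat) auto
  \<comment> \<open>Swapping the factors of the second half makes the exponents \<open>q\<close> and
    \<open>- q\<close> adjacent, where they cancel.\<close>
  also have "addrow_mat N (s * int a) i j * addrow_mat N (-1 * q) k j
      = addrow_mat N (-1 * q) k j * addrow_mat N (s * int a) i j"
    using assms k by (intro addrow_mat_commute) auto
  also have "addrow_mat N (s * int a) i j * addrow_mat N (1 * q) k j * \<dots>
      = addrow_mat N (s * int a) i j * (addrow_mat N (1 * q) k j * addrow_mat N (-1 * q) k j) *
        addrow_mat N (s * int a) i j"
    by (simp add: assoc_mult_mat[of _ N N _ N _ N] mult_carrier_mat[of _ N N _ N])
  also have "\<dots> * addrow_mat N (s * b) i j = addrow_mat N m i j"
    using assms k by (simp add: addrow_mat_add addrow_mat_zero m algebra_simps)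
  also have "\<dots> = elem_mat N i j [^]\<^bsub>SL_Z N\<^esub> m"
    using assms by (simp add: elem_mat_int_pow)
  finally obtain w where w: "w \<in> lists (letters N)" "eval_word N w = elem_mat N i j [^]\<^bsub>SL_Z N\<^esub> m"
    "length w \<le> 6 * n + 1"
    unfolding spelled_within_def by auto
  \<comment> \<open>For \<open>n > 0\<close>, minimality gives \<open>tau ^ (n - 1) \<le> a\<close>;
    the missing factor \<open>tau \<le> 2\<close> is absorbed by
    \<open>2 * a \<le> \<bar>m\<bar>\<close>. The summand \<open>1\<close> covers
    \<open>n = 0\<close>.\<close>
  have "tau ^ n \<le> 1 + real_of_int \<bar>m\<bar> * sqrt 5"
  proof (cases n)
    case 0
    then show ?thesis by simp
  next
    case (Suc n')
    then have "\<not> a < fib (n' + 2)" unfolding n_def by (intro not_less_Least) simp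
    then have "tau ^ n' \<le> real a" using tau_power_le_fib[of n'] by linarith
    then have "tau ^ n \<le> 2 * real a"
      using Suc tau_le_2 tau_gt_1 by (auto intro!: mult_mono)
    also have "\<dots> \<le> real_of_int \<bar>m\<bar>" unfolding a_def by linarith
    also have "\<dots> \<le> real_of_int \<bar>m\<bar> * sqrt 5" by (simp add: mult_le_cancel_left1)
    finally show ?thesis by simp
  qed
  then have "real n \<le> log tau (1 + real_of_int \<bar>m\<bar> * sqrt 5)"
    using tau_gt_1 by (intro le_log_of_power) auto
  then show ?thesis
    using w by (intro exI[of _ w]) auto
qed

end
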